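(* Let $\alpha>-\frac12$. (1) The normalized Bessel function $j_\alpha$ is positive definite on $\mathbb{R}$, i.e. $j_\alpha\in\mathcal{P}$. (2) Let $\mu$ be a nonnegative finite Borel measure on $\mathbb{R}$ whose Fourier transform $\hat\mu$ is strictly positive definite on $\mathbb{R}$, i.e. $\hat\mu\in\mathcal{P}^s$. Then the function $\xi\mapsto\int_{\mathbb{R}} j_\alpha(x\xi)\,d\mu(x)$ on $\mathbb{R}$ belongs to $\mathcal{P}^s$.
   Context: A continuous function $f:\mathbb{R}\to\mathbb{C}$ is positive definite (resp. strictly positive definite) on $\mathbb{R}$ if for every $N\ge1$, all pairwise distinct real numbers $x_1,\dots,x_N$ and all complex numbers $z_1,\dots,z_N$ not all zero, $\sum_{j=1}^N\sum_{k=1}^N z_j\overline{z_k}f(x_j-x_k)\ge0$ (resp. $>0$). $\mathcal{P}$ (resp. $\mathcal{P}^s$) denotes the class of positive definite (resp. strictly positive definite) functions on $\mathbb{R}$. For $\alpha>-\frac12$, the normalized Bessel function is the even function on $\mathbb{R}$ given by $j_\alpha(x)=\sum_{n=0}^{\infty}\frac{(-1)^n\Gamma(\alpha+1)}{n!\,\Gamma(n+\alpha+1)}\left(\frac{x}{2}\right)^{2n}$ (equivalently $2^\alpha\Gamma(\alpha+1)J_\alpha(x)/x^\alpha$ for $x>0$ and $1$ at $x=0$). The Fourier transform of a finite measure is $\hat\mu(\xi)=\int_{\mathbb{R}}e^{-ix\xi}\,d\mu(x)$. *)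

theory Defs
  imports "HOL-Analysis.Analysis" "HOL-Library.Complex_Order"
begin

text \<open>
  The inequalities between complex numbers below are those of \<^theory>\<open>HOL-Library.Complex_Order\<close>:
  they assert in particular that the quadratic form is real.
\<close>

definition positive_definite :: "(real \<Rightarrow> complex) \<Rightarrow> bool" where
  "positive_definite f \<longleftrightarrow> continuous_on UNIV f \<and>
     (\<forall>N\<ge>1. \<forall>(x :: nat \<Rightarrow> real) (z :: nat \<Rightarrow> complex).
        inj_on x {1..N} \<longrightarrow> (\<exists>j\<in>{1..N}. z j \<noteq> 0) \<longrightarrow>
        (\<Sum>j=1..N. \<Sum>k=1..N. z j * cnj (z k) * f (x j - x k)) \<ge> 0)"

definition strictly_positive_definite :: "(real \<Rightarrow> complex) \<Rightarrow> bool" where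
  "strictly_positive_definite f \<longleftrightarrow> continuous_on UNIV f \<and>
     (\<forall>N\<ge>1. \<forall>(x :: nat \<Rightarrow> real) (z :: nat \<Rightarrow> complex).
        inj_on x {1..N} \<longrightarrow> (\<exists>j\<in>{1..N}. z j \<noteq> 0) \<longrightarrow>
        (\<Sum>j=1..N. \<Sum>k=1..N. z j * cnj (z k) * f (x j - x k)) > 0)"

definition bessel_coeff :: "real \<Rightarrow> nat \<Rightarrow> real" where
  "bessel_coeff \<alpha> n = (-1) ^ n * Gamma (\<alpha> + 1) / (fact n * Gamma (real n + \<alpha> + 1))"

definition normalized_bessel :: "real \<Rightarrow> real \<Rightarrow> real" where
  "normalized_bessel \<alpha> x = (\<Sum>n. bessel_coeff \<alpha> n * (x / 2) ^ (2 * n))"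

definition fourier_measure :: "real measure \<Rightarrow> real \<Rightarrow> complex" where
  "fourier_measure \<mu> \<xi> = (\<integral>x. exp (- (\<i> * of_real (x * \<xi>))) \<partial>\<mu>)"

lemma bessel_coeff_Suc:
  assumes "\<alpha> > -1/2"
  shows "bessel_coeff \<alpha> (Suc n) = - bessel_coeff \<alpha> n / (real (Suc n) * (real n + \<alpha> + 1))"
proof -
  have p: "real n + \<alpha> + 1 > 0" using assms by linarith
  have "real n + \<alpha> + 1 \<notin> \<int>\<^sub>\<le>\<^sub>0" using p by (auto elim!: nonpos_Ints_cases)
  then have "Gamma (real (Suc n) + \<alpha> + 1) = (real n + \<alpha> + 1) * Gamma (real n + \<alpha> + 1)"
    using Gamma_plus1[of "real n + \<alpha> + 1"] by (simp add: add_ac)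
  then show ?thesis
    unfolding bessel_coeff_def by (simp add: mult_ac)
qed

text \<open>The defining series converges everywhere, so the value of \<^const>\<open>suminf\<close> is meaningful.\<close>

lemma summable_normalized_bessel:
  assumes "\<alpha> > -1/2"
  shows "summable (\<lambda>n. bessel_coeff \<alpha> n * (x / 2) ^ (2 * n))"
proof -
  define N where "N = nat \<lceil>x\<^sup>2\<rceil> + 1"
  show ?thesis
  proof (rule summable_ratio_test[where c = "1/2" and N = N])
    fix n assume n: "n \<ge> N"
    have d: "real n + \<alpha> + 1 \<ge> 1/2" using assms by linarith
    have "x\<^sup>2 \<le> real n" using n unfolding N_def by linarith
    then have "(x/2)\<^sup>2 \<le> real (Suc n) * (1/2) * (1/2)" by (simp add: power2_eq_square)
    also have "\<dots> \<le> 1/2 * (real (Suc n) * (real n + \<alpha> + 1))"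
      using mult_left_mono[OF d, of "real (Suc n) * (1/2)"] by (simp add: mult_ac)
    finally have le: "(x/2)\<^sup>2 \<le> 1/2 * (real (Suc n) * (real n + \<alpha> + 1))" .
    have pos: "real (Suc n) * (real n + \<alpha> + 1) > 0" using d by simp
    define D where "D = real (Suc n) * (real n + \<alpha> + 1)"
    have pw: "(x / 2) ^ (2 * Suc n) = (x/2)\<^sup>2 * (x / 2) ^ (2 * n)"
      by (simp only: power_add[symmetric]) simp
    have "norm (bessel_coeff \<alpha> (Suc n) * (x / 2) ^ (2 * Suc n)) =
            (x/2)\<^sup>2 / D * norm (bessel_coeff \<alpha> n * (x / 2) ^ (2 * n))"
      using pos unfolding bessel_coeff_Suc[OF assms] D_def[symmetric] pw
      by (simp add: abs_mult)
    also have "\<dots> \<le> 1/2 * norm (bessel_coeff \<alpha> n * (x / 2) ^ (2 * n))"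
      using le pos unfolding D_def[symmetric]
      by (intro mult_right_mono) (auto simp: divide_le_eq)
    finally show "norm (bessel_coeff \<alpha> (Suc n) * (x / 2) ^ (2 * Suc n))
                   \<le> 1/2 * norm (bessel_coeff \<alpha> n * (x / 2) ^ (2 * n))" .
  qed simp
qed

end

theory Submission
  imports Defs
begin

text \<open>
  The function \<open>j\<^sub>\<alpha>\<close> is a mixture of cosines. If \<open>M\<close> is the Beta distribution on \<open>(0,1)\<close> with
  parameters \<open>1/2\<close> and \<open>\<alpha> + 1/2\<close>, then \<open>j\<^sub>\<alpha>(x) = \<integral> cos (x \<surd>s) dM(s)\<close>
  (lemma \<open>normalized_bessel_eq_integral\<close>). This is Poisson's integral after the substitution
  \<open>s = t\<^sup>2\<close>, in which the even integrand on \<open>(-1,1)\<close> becomes a Beta density, so that the expansion of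
  the cosine can be integrated termwise with the known moments of \<open>M\<close>.

  The quadratic form of \<open>\<xi> \<mapsto> cos (u \<xi>)\<close> at nodes \<open>x\<^sub>j\<close> with coefficients \<open>z\<^sub>j\<close> is
  \<open>E(u) = (\<bar>A(u)\<bar>\<^sup>2 + \<bar>A(-u)\<bar>\<^sup>2) / 2\<close>, where \<open>A(u) = \<Sum>\<^sub>j z\<^sub>j exp (- i u x\<^sub>j)\<close>. Integrating
  over \<open>M\<close>, the form of \<open>\<xi> \<mapsto> j\<^sub>\<alpha>(y \<xi>)\<close> is \<open>F(y) = \<integral> E(y \<surd>s) dM(s) \<ge> 0\<close>, and \<open>y = 1\<close> gives
  positive definiteness.

  For a measure \<open>\<mu>\<close>, the form of \<open>\<xi> \<mapsto> \<integral> j\<^sub>\<alpha>(y \<xi>) d\<mu>(y)\<close> is \<open>\<integral> F d\<mu>\<close>. If it vanishes, then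
  \<open>F(y) = 0\<close> for \<open>\<mu>\<close>-almost every \<open>y\<close>. For each such \<open>y\<close>, the function \<open>s \<mapsto> E(y \<surd>s)\<close> is continuous,
  nonnegative, and has integral zero against a density that is positive on \<open>(0,1)\<close>; hence it vanishes
  on all of \<open>(0,1)\<close>, in particular at \<open>s = 1/4\<close>. Thus \<open>A(y/2) = 0\<close> for \<open>\<mu>\<close>-almost every \<open>y\<close>. But
  \<open>\<integral> \<bar>A(y/2)\<bar>\<^sup>2 d\<mu>(y)\<close> is the quadratic form of the Fourier transform of \<open>\<mu>\<close> at the distinct nodes
  \<open>x\<^sub>j/2\<close>, so strict positive definiteness of that transform is contradicted. Fixing one value of \<open>s\<close>
  common to all \<open>y\<close> means that no double integral has to be interchanged.
\<close>

section \<open>Quadratic forms of exponentials and cosines\<close>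

definition quad_form :: "nat \<Rightarrow> (nat \<Rightarrow> real) \<Rightarrow> (nat \<Rightarrow> complex) \<Rightarrow> (real \<Rightarrow> complex) \<Rightarrow> complex" where
  "quad_form N x z f = (\<Sum>j=1..N. \<Sum>k=1..N. z j * cnj (z k) * f (x j - x k))"

definition exp_poly :: "nat \<Rightarrow> (nat \<Rightarrow> real) \<Rightarrow> (nat \<Rightarrow> complex) \<Rightarrow> real \<Rightarrow> complex" where
  "exp_poly N x z u = (\<Sum>j=1..N. z j * exp (- (\<i> * of_real (u * x j))))"

text \<open>
  The nodes and coefficients are kept fixed while the frequency \<open>u\<close> varies: this is the value of the
  quadratic form on \<open>\<xi> \<mapsto> cos (u \<xi>)\<close>, see \<open>quad_form_cos\<close> below.
\<close>
definition cos_energy :: "nat \<Rightarrow> (nat \<Rightarrow> real) \<Rightarrow> (nat \<Rightarrow> complex) \<Rightarrow> real \<Rightarrow> real" where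
  "cos_energy N x z u = ((cmod (exp_poly N x z u))\<^sup>2 + (cmod (exp_poly N x z (- u)))\<^sup>2) / 2"

text \<open>
  The kernel \<open>exp (- i u (x\<^sub>j - x\<^sub>k))\<close> factors into a function of \<open>x\<^sub>j\<close> times the conjugate of the same
  function of \<open>x\<^sub>k\<close>, so the double sum is a square.
\<close>
lemma quad_form_exp:
  "quad_form N x z (\<lambda>\<xi>. exp (- (\<i> * of_real (u * \<xi>)))) = of_real ((cmod (exp_poly N x z u))\<^sup>2)"
proof -
  have "of_real ((cmod (exp_poly N x z u))\<^sup>2) = exp_poly N x z u * cnj (exp_poly N x z u)"
    by (rule complex_norm_square)
  also have "\<dots> = (\<Sum>j=1..N. \<Sum>k=1..N. (z j * exp (- (\<i> * of_real (u * x j)))) *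
      cnj (z k * exp (- (\<i> * of_real (u * x k)))))"
    unfolding exp_poly_def cnj_sum sum_product ..
  also have "\<dots> = quad_form N x z (\<lambda>\<xi>. exp (- (\<i> * of_real (u * \<xi>))))"
    unfolding quad_form_def
  proof (intro sum.cong refl)
    fix j k
    have "exp (- (\<i> * of_real (u * (x j - x k)))) =
        exp (- (\<i> * of_real (u * x j))) * cnj (exp (- (\<i> * of_real (u * x k))))"
      by (simp add: exp_cnj exp_add[symmetric] algebra_simps)
    then show "z j * exp (- (\<i> * of_real (u * x j))) * cnj (z k * exp (- (\<i> * of_real (u * x k)))) =
        z j * cnj (z k) * exp (- (\<i> * of_real (u * (x j - x k))))"
      by (simp add: mult_ac)
  qed
  finally show ?thesis ..
qed

lemma quad_form_cos:
  "quad_form N x z (\<lambda>\<xi>. of_real (cos (u * \<xi>))) = of_real (cos_energy N x z u)"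
proof -
  have cos: "complex_of_real (cos (u * \<xi>)) =
      (exp (- (\<i> * of_real (u * \<xi>))) + exp (- (\<i> * of_real (- u * \<xi>)))) / 2" for \<xi>
    by (simp add: cos_exp_eq cos_of_real[symmetric] add.commute)
  have "quad_form N x z (\<lambda>\<xi>. of_real (cos (u * \<xi>))) =
      (quad_form N x z (\<lambda>\<xi>. exp (- (\<i> * of_real (u * \<xi>)))) +
       quad_form N x z (\<lambda>\<xi>. exp (- (\<i> * of_real (- u * \<xi>))))) / 2"
    unfolding quad_form_def cos
    by (simp add: sum.distrib[symmetric] sum_divide_distrib algebra_simps add_divide_distrib)
  then show ?thesis
    unfolding quad_form_exp cos_energy_def by simp
qed

lemma cos_energy_nonneg: "cos_energy N x z u \<ge> 0"
  by (simp add: cos_energy_def)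

lemma cos_energy_eq_0_imp: "cos_energy N x z u = 0 \<Longrightarrow> exp_poly N x z u = 0"
  by (simp add: cos_energy_def add_nonneg_eq_0_iff)

lemma continuous_on_cos_energy: "continuous_on A (cos_energy N x z)"
  unfolding cos_energy_def exp_poly_def by (intro continuous_intros) auto

section \<open>Mixtures over a measure\<close>

lemma quad_form_integral:
  assumes "\<And>\<xi>. integrable M (\<lambda>y. f y \<xi>)"
  shows "integrable M (\<lambda>y. quad_form N x z (f y))"
    and "quad_form N x z (\<lambda>\<xi>. \<integral>y. f y \<xi> \<partial>M) = (\<integral>y. quad_form N x z (f y) \<partial>M)"
  unfolding quad_form_def using assms by (simp_all add: Bochner_Integration.integral_sum)

text \<open>
  The definiteness conditions compare complex numbers, whereas the integrals to be estimated are real.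
  This version moves a real family through the integral and keeps its real quadratic form \<open>q\<close>.
\<close>
lemma quad_form_integral_real:
  assumes int: "\<And>\<xi>. integrable M (\<lambda>y. f y \<xi>)"
    and form: "\<And>y. quad_form N x z (\<lambda>\<xi>. of_real (f y \<xi>)) = of_real (q y)"
  shows "integrable M q"
    and "quad_form N x z (\<lambda>\<xi>. of_real (\<integral>y. f y \<xi> \<partial>M)) = of_real (\<integral>y. q y \<partial>M)"
proof -
  have int': "integrable M (\<lambda>y. complex_of_real (f y \<xi>))" for \<xi>
    using int by (simp add: complex_of_real_integrable_eq)
  show "integrable M q"
    using quad_form_integral(1)[where f = "\<lambda>y \<xi>. complex_of_real (f y \<xi>)", OF int', of N x z] unfolding form
    by (simp add: complex_of_real_integrable_eq)
  show "quad_form N x z (\<lambda>\<xi>. of_real (\<integral>y. f y \<xi> \<partial>M)) = of_real (\<integral>y. q y \<partial>M)"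
    using quad_form_integral(2)[where f = "\<lambda>y \<xi>. complex_of_real (f y \<xi>)", OF int', of N x z] unfolding form by simp
qed

lemma continuous_on_integral_bounded:
  fixes f :: "'a \<Rightarrow> real \<Rightarrow> real"
  assumes "finite_measure M"
    and meas: "\<And>\<xi>. (\<lambda>y. f y \<xi>) \<in> borel_measurable M"
    and cont: "\<And>y. continuous_on UNIV (f y)"
    and bound: "\<And>y \<xi>. \<bar>f y \<xi>\<bar> \<le> B"
  shows "continuous_on UNIV (\<lambda>\<xi>. \<integral>y. f y \<xi> \<partial>M)"
  unfolding continuous_on_sequentially
proof (intro allI ballI impI)
  interpret finite_measure M by fact
  fix X :: "nat \<Rightarrow> real" and a
  assume "(\<forall>n. X n \<in> UNIV) \<and> X \<longlonglongrightarrow> a"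
  then have "(\<lambda>n. f y (X n)) \<longlonglongrightarrow> f y a" for y
    using cont[of y] unfolding continuous_on_sequentially by (auto simp: o_def)
  then have "(\<lambda>n. \<integral>y. f y (X n) \<partial>M) \<longlonglongrightarrow> (\<integral>y. f y a \<partial>M)"
    by (intro integral_dominated_convergence[where w = "\<lambda>_. B"])
       (use meas bound in auto)
  then show "((\<lambda>\<xi>. \<integral>y. f y \<xi> \<partial>M) \<circ> X) \<longlonglongrightarrow> (\<integral>y. f y a \<partial>M)"
    by (simp add: o_def)
qed

text \<open>
  The set where \<open>g\<close> does not vanish inside \<open>U\<close> is open, and a nonempty open set is not a null set. The
  point is to pass from almost every \<open>s\<close>, with an exceptional set depending on \<open>g\<close>, to one prescribed
  point \<open>t\<close>.
\<close>
lemma AE_lborel_continuous_eq_0: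
  fixes g :: "real \<Rightarrow> real"
  assumes "continuous_on UNIV g" and "open U" and "AE s in lborel. s \<in> U \<longrightarrow> g s = 0" and "t \<in> U"
  shows "g t = 0"
proof (rule ccontr)
  assume "g t \<noteq> 0"
  have op: "open {s \<in> U. g s \<noteq> 0}"
  proof -
    have "open (U \<inter> g -` (- {0}))"
      using assms(1,2) by (intro open_Int) (auto simp: continuous_on_open_vimage)
    then show ?thesis by (simp add: Int_def vimage_def)
  qed
  have "{s \<in> U. g s \<noteq> 0} \<in> null_sets lborel"
    using assms(3) op by (subst AE_iff_null_sets) (auto elim: eventually_mono)
  then have "negligible {s \<in> U. g s \<noteq> 0}"
    by (simp add: negligible_iff_null_sets null_sets_completionI)
  then show False
    using open_not_negligible[OF op] assms(4) \<open>g t \<noteq> 0\<close> by auto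
qed

section \<open>The Beta distribution and its moments\<close>

text \<open>
  The distribution of \<open>t\<^sup>2\<close> when \<open>t\<close> has density proportional to \<open>(1 - t\<^sup>2) powr (\<alpha> - 1/2)\<close> on
  \<open>(-1,1)\<close>, which is the weight in Poisson's integral.
\<close>
definition beta_measure :: "real \<Rightarrow> real measure" where
  "beta_measure \<alpha> = density lborel (\<lambda>s. indicator {0<..<1} s *
     (s powr (-1/2) * (1 - s) powr (\<alpha> - 1/2)) / Beta (1/2) (\<alpha> + 1/2))"

lemma Beta_real_pos: "a > 0 \<Longrightarrow> b > 0 \<Longrightarrow> Beta a b > (0::real)"
  by (simp add: Beta_def)

lemma beta_measure_moment:
  assumes "\<alpha> > -1/2"
  shows "has_bochner_integral (beta_measure \<alpha>) (\<lambda>s. s ^ n)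
    (Beta (real n + 1/2) (\<alpha> + 1/2) / Beta (1/2) (\<alpha> + 1/2))"
proof -
  let ?w = "\<lambda>s. indicator {0<..<1} s * (s powr (-1/2) * (1 - s) powr (\<alpha> - 1/2)) / Beta (1/2) (\<alpha> + 1/2)"
  let ?g = "\<lambda>s. s powr (real n + 1/2 - 1) * (1 - s) powr (\<alpha> + 1/2 - 1)"
  have B: "Beta (1/2) (\<alpha> + 1/2) > 0" using assms by (intro Beta_real_pos) auto
  have pos: "Beta (real n + 1/2) (\<alpha> + 1/2) > 0" using assms by (intro Beta_real_pos) auto
  have "(?g has_integral Beta (real n + 1/2) (\<alpha> + 1/2)) {0<..<1}"
    using has_integral_Beta_real[of "real n + 1/2" "\<alpha> + 1/2"] assms
    by (simp add: has_integral_Icc_iff_Ioo)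
  then have "(\<integral>\<^sup>+s. ennreal (indicator {0<..<1} s * ?g s) \<partial>lborel) = ennreal (Beta (real n + 1/2) (\<alpha> + 1/2))"
    by (intro nn_integral_has_integral_lebesgue) auto
  then have "has_bochner_integral lborel (\<lambda>s. indicator {0<..<1} s * ?g s) (Beta (real n + 1/2) (\<alpha> + 1/2))"
    using pos by (intro has_bochner_integral_nn_integral) auto
  then have "has_bochner_integral lborel (\<lambda>s. (indicator {0<..<1} s * ?g s) / Beta (1/2) (\<alpha> + 1/2))
      (Beta (real n + 1/2) (\<alpha> + 1/2) / Beta (1/2) (\<alpha> + 1/2))"
    using B by (intro has_bochner_integral_divide_zero)
  moreover have "(indicator {0<..<1} s * ?g s) / Beta (1/2) (\<alpha> + 1/2) = ?w s *\<^sub>R s ^ n" for s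
  proof (cases "s \<in> {0<..<1}")
    case True
    then have "s powr (real n + 1/2 - 1) = s powr (-1/2) * s ^ n"
      by (simp add: powr_realpow[symmetric] powr_add[symmetric])
    then show ?thesis by (simp add: mult_ac)
  qed auto
  ultimately have "has_bochner_integral lborel (\<lambda>s. ?w s *\<^sub>R s ^ n)
      (Beta (real n + 1/2) (\<alpha> + 1/2) / Beta (1/2) (\<alpha> + 1/2))"
    by (simp only:)
  then show ?thesis
    unfolding beta_measure_def using B
    by (subst has_bochner_integral_density) auto
qed

lemma beta_measure_moment_Suc:
  assumes "\<alpha> > -1/2"
  shows "(\<integral>s. s ^ Suc n \<partial>beta_measure \<alpha>) =
    (real n + 1/2) / (real n + \<alpha> + 1) * (\<integral>s. s ^ n \<partial>beta_measure \<alpha>)"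
proof -
  have "real n + 1/2 \<notin> \<int>\<^sub>\<le>\<^sub>0" by (auto elim!: nonpos_Ints_cases)
  from Beta_plus1_left[OF this, of "\<alpha> + 1/2"]
  have "Beta (real (Suc n) + 1/2) (\<alpha> + 1/2) =
      (real n + 1/2) / (real n + \<alpha> + 1) * Beta (real n + 1/2) (\<alpha> + 1/2)"
    using assms by (simp add: field_simps)
  then show ?thesis
    unfolding has_bochner_integral_integral_eq[OF beta_measure_moment[OF assms]] by simp
qed

lemma sets_beta_measure [measurable_cong, simp]: "sets (beta_measure \<alpha>) = sets borel"
  by (simp add: beta_measure_def)

lemma beta_measure_total_mass:
  assumes "\<alpha> > -1/2"
  shows "finite_measure (beta_measure \<alpha>)" and "measure (beta_measure \<alpha>) UNIV = 1"
proof -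
  have *: "has_bochner_integral (beta_measure \<alpha>) (\<lambda>s. 1::real) 1"
    using beta_measure_moment[OF assms, of 0] Beta_real_pos[of "1/2" "\<alpha> + 1/2"] assms by simp
  have sp: "space (beta_measure \<alpha>) = UNIV" by (simp add: beta_measure_def)
  have "integrable (beta_measure \<alpha>) (indicator UNIV :: real \<Rightarrow> real)"
    using * by (simp add: has_bochner_integral_iff)
  then have "emeasure (beta_measure \<alpha>) UNIV < \<infinity>"
    unfolding integrable_indicator_iff sp by simp
  then show "finite_measure (beta_measure \<alpha>)"
    by (intro finite_measureI) (simp add: sp)
  show "measure (beta_measure \<alpha>) UNIV = 1"
    using * sp by (simp add: has_bochner_integral_iff)
qed

text \<open>
  The density is strictly positive on \<open>(0,1)\<close>, so this distribution has the null sets of Lebesgue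
  measure there.
\<close>
lemma AE_beta_measure:
  assumes "\<alpha> > -1/2"
  shows "(AE s in beta_measure \<alpha>. P s) \<longleftrightarrow> (AE s in lborel. s \<in> {0<..<1} \<longrightarrow> P s)"
proof -
  have B: "Beta (1/2) (\<alpha> + 1/2) > 0" using assms by (intro Beta_real_pos) auto
  let ?w = "\<lambda>s. ennreal (indicator {0<..<1} s * (s powr (-1/2) * (1 - s) powr (\<alpha> - 1/2)) /
    Beta (1/2) (\<alpha> + 1/2))"
  have w: "?w \<in> borel_measurable lborel"
    by measurable
  have "?w s > 0 \<longleftrightarrow> s \<in> {0<..<1}" for s
    using B by (auto simp: indicator_def)
  then show ?thesis
    unfolding beta_measure_def AE_density[OF w] by (simp only:)
qed

section \<open>Poisson's integral for the normalized Bessel function\<close>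

text \<open>
  Both sides satisfy the same first-order recursion in \<open>n\<close>: passing to \<open>n + 1\<close>, the moment gains the
  factor \<open>(n + 1/2) / (n + \<alpha> + 1)\<close> and the factorial gains \<open>(2n + 1)(2n + 2) = 4 (n + 1)(n + 1/2)\<close>; the
  factor \<open>n + 1/2\<close> cancels.
\<close>
lemma bessel_coeff_eq_moment:
  assumes "\<alpha> > -1/2"
  shows "bessel_coeff \<alpha> n / 4 ^ n = (-1) ^ n / fact (2 * n) * (\<integral>s. s ^ n \<partial>beta_measure \<alpha>)"
proof (induction n)
  case 0
  have "Gamma (\<alpha> + 1) > 0" using assms by (intro Gamma_real_pos) auto
  then show ?case
    using beta_measure_total_mass(2)[OF assms] by (simp add: bessel_coeff_def beta_measure_def)
next
  case (Suc n)
  let ?m = "\<integral>s. s ^ n \<partial>beta_measure \<alpha>"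
  have f: "fact (2 * Suc n) = 4 * real (Suc n) * (real n + 1/2) * (fact (2 * n) :: real)"
    by (simp add: algebra_simps)
  have "bessel_coeff \<alpha> (Suc n) / 4 ^ Suc n =
      - (bessel_coeff \<alpha> n / 4 ^ n) / (4 * real (Suc n) * (real n + \<alpha> + 1))"
    by (simp add: bessel_coeff_Suc[OF assms])
  also have "\<dots> = - ((-1) ^ n / fact (2 * n) * ?m) / (4 * real (Suc n) * (real n + \<alpha> + 1))"
    unfolding Suc.IH ..
  also have "\<dots> = (-1) ^ Suc n / fact (2 * Suc n) * ((real n + 1/2) / (real n + \<alpha> + 1) * ?m)"
  proof -
    have "- (A / F * m) / (4 * K * D) = - A / (4 * K * h * F) * ((h / D) * m)"
      if "h \<noteq> 0" for A F m K D h :: real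
      using that by simp
    note eq = this[of "real n + 1/2" "(-1) ^ n" "fact (2 * n)" ?m "real (Suc n)" "real n + \<alpha> + 1"]
    have "real n + 1/2 \<noteq> 0" by linarith
    from eq[OF this] show ?thesis
      unfolding f power_Suc by (simp only: mult_minus1)
  qed
  finally show ?case unfolding beta_measure_moment_Suc[OF assms] .
qed

text \<open>
  The cosine series \<open>cos (x \<surd>s) = \<Sum>\<^sub>n (-1)\<^sup>n x\<^sup>2\<^sup>n s\<^sup>n / (2n)!\<close> is a power series in \<open>s\<close>. On \<open>(0,1)\<close> its
  terms are dominated by \<open>\<bar>x\<bar>\<^sup>2\<^sup>n / (2n)!\<close>, uniformly in \<open>s\<close>, so it may be integrated termwise.
\<close>
lemma normalized_bessel_eq_integral:
  assumes "\<alpha> > -1/2"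
  shows "normalized_bessel \<alpha> x = (\<integral>s. cos (sqrt s * x) \<partial>beta_measure \<alpha>)"
proof -
  interpret M: finite_measure "beta_measure \<alpha>" by (rule beta_measure_total_mass[OF assms])
  let ?c = "\<lambda>n. (-1) ^ n / fact (2 * n) * x ^ (2 * n)"
  let ?f = "\<lambda>n s. ?c n * s ^ n"
  have mom: "integrable (beta_measure \<alpha>) (\<lambda>s. s ^ n)" for n
    using beta_measure_moment[OF assms] by (simp add: has_bochner_integral_iff)
  have unit: "AE s in beta_measure \<alpha>. s \<in> {0<..<1}"
    unfolding AE_beta_measure[OF assms] by simp
  have abs_summable: "summable (\<lambda>n. \<bar>y\<bar> ^ (2 * n) / fact (2 * n))" for y :: real
  proof (rule summable_comparison_test'[OF summable_exp[of "y\<^sup>2"]])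
    fix n :: nat
    have "\<bar>y\<bar> ^ (2 * n) / fact (2 * n) \<le> \<bar>y\<bar> ^ (2 * n) / fact n"
      by (intro divide_left_mono fact_mono mult_pos_pos) auto
    then show "norm (\<bar>y\<bar> ^ (2 * n) / fact (2 * n)) \<le> inverse (fact n) * (y\<^sup>2) ^ n"
      by (simp add: power_mult[of _ 2] divide_inverse mult.commute[of "inverse _"])
  qed
  have "(\<lambda>n. integral\<^sup>L (beta_measure \<alpha>) (?f n)) sums (\<integral>s. (\<Sum>n. ?f n s) \<partial>beta_measure \<alpha>)"
  proof (rule sums_integral)
    show "integrable (beta_measure \<alpha>) (?f n)" for n
      using mom by simp
    show "AE s in beta_measure \<alpha>. summable (\<lambda>n. norm (?f n s))"
      using unit
    proof eventually_elim
      case (elim s)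
      have "norm (?f n s) \<le> \<bar>x\<bar> ^ (2 * n) / fact (2 * n)" for n
        using elim by (auto simp: abs_mult power_abs intro!: mult_left_le power_le_one divide_right_mono)
      then show ?case by (intro summable_comparison_test'[OF abs_summable[of x]]) auto
    qed
    show "summable (\<lambda>n. \<integral>s. norm (?f n s) \<partial>beta_measure \<alpha>)"
    proof (rule summable_comparison_test'[OF abs_summable[of x]])
      fix n
      have "(\<integral>s. norm (?f n s) \<partial>beta_measure \<alpha>) \<le> (\<integral>s. \<bar>x\<bar> ^ (2 * n) / fact (2 * n) \<partial>beta_measure \<alpha>)"
      proof (rule integral_mono_AE)
        show "AE s in beta_measure \<alpha>. norm (?f n s) \<le> \<bar>x\<bar> ^ (2 * n) / fact (2 * n)"
          using unit by eventually_elim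
            (auto simp: abs_mult power_abs intro!: mult_left_le power_le_one divide_right_mono)
      qed (use mom in auto)
      also have "\<dots> = \<bar>x\<bar> ^ (2 * n) / fact (2 * n)"
        using beta_measure_total_mass(2)[OF assms] by (simp add: beta_measure_def)
      finally show "norm (\<integral>s. norm (?f n s) \<partial>beta_measure \<alpha>) \<le> \<bar>x\<bar> ^ (2 * n) / fact (2 * n)"
        by simp
    qed
  qed
  moreover have "integral\<^sup>L (beta_measure \<alpha>) (?f n) = bessel_coeff \<alpha> n * (x / 2) ^ (2 * n)" for n
  proof -
    have "bessel_coeff \<alpha> n * (x / 2) ^ (2 * n) = bessel_coeff \<alpha> n / 4 ^ n * x ^ (2 * n)"
      by (simp add: power_mult power_divide)
    then show ?thesis unfolding bessel_coeff_eq_moment[OF assms] by simp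
  qed
  moreover have "(\<integral>s. (\<Sum>n. ?f n s) \<partial>beta_measure \<alpha>) = (\<integral>s. cos (sqrt s * x) \<partial>beta_measure \<alpha>)"
  proof (rule integral_cong_AE)
    show "AE s in beta_measure \<alpha>. (\<Sum>n. ?f n s) = cos (sqrt s * x)"
      using unit
    proof eventually_elim
      case (elim s)
      have "?f n s = (- 1) ^ n / (fact (2 * n)) * (sqrt s * x) ^ (2 * n)" for n
        using elim by (simp add: power_mult power_mult_distrib)
      then show ?case using sums_unique[OF cos_paired[of "sqrt s * x"]] by (simp only:)
    qed
  qed measurable
  ultimately show ?thesis
    unfolding normalized_bessel_def by (simp add: sums_iff)
qed

lemma abs_normalized_bessel_le_1:
  assumes "\<alpha> > -1/2"
  shows "\<bar>normalized_bessel \<alpha> x\<bar> \<le> 1"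
proof -
  interpret M: finite_measure "beta_measure \<alpha>" by (rule beta_measure_total_mass[OF assms])
  have "\<bar>normalized_bessel \<alpha> x\<bar> \<le> (\<integral>s. 1 \<partial>beta_measure \<alpha>)"
    unfolding normalized_bessel_eq_integral[OF assms]
    by (rule integral_abs_bound_integral)
       (auto intro!: M.integrable_const_bound[where B = 1])
  also have "\<dots> = 1" using beta_measure_total_mass(2)[OF assms] by (simp add: beta_measure_def)
  finally show ?thesis .
qed

lemma continuous_on_normalized_bessel:
  assumes "\<alpha> > -1/2"
  shows "continuous_on UNIV (normalized_bessel \<alpha>)"
  unfolding normalized_bessel_eq_integral[OF assms, abs_def]
  by (rule continuous_on_integral_bounded[where B = 1, OF beta_measure_total_mass(1)[OF assms]])
     (auto intro!: continuous_intros)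

section \<open>Positive definiteness\<close>

lemma quad_form_normalized_bessel:
  assumes "\<alpha> > -1/2"
  shows "integrable (beta_measure \<alpha>) (\<lambda>s. cos_energy N x z (sqrt s * y))"
    and "quad_form N x z (\<lambda>\<xi>. of_real (normalized_bessel \<alpha> (y * \<xi>))) =
      of_real (\<integral>s. cos_energy N x z (sqrt s * y) \<partial>beta_measure \<alpha>)"
proof -
  interpret M: finite_measure "beta_measure \<alpha>" by (rule beta_measure_total_mass[OF assms])
  have int: "integrable (beta_measure \<alpha>) (\<lambda>s. cos (sqrt s * y * \<xi>))" for \<xi>
    by (rule M.integrable_const_bound[where B = 1]) auto
  note * = quad_form_integral_real[OF int quad_form_cos]
  show "integrable (beta_measure \<alpha>) (\<lambda>s. cos_energy N x z (sqrt s * y))"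
    by (rule *(1))
  show "quad_form N x z (\<lambda>\<xi>. of_real (normalized_bessel \<alpha> (y * \<xi>))) =
      of_real (\<integral>s. cos_energy N x z (sqrt s * y) \<partial>beta_measure \<alpha>)"
    unfolding normalized_bessel_eq_integral[OF assms] mult.assoc[symmetric] by (rule *(2))
qed

lemma cos_energy_eq_0_of_integral_eq_0:
  assumes "\<alpha> > -1/2" and "(\<integral>s. cos_energy N x z (sqrt s * y) \<partial>beta_measure \<alpha>) = 0"
    and "0 < t" "t < 1"
  shows "cos_energy N x z (sqrt t * y) = 0"
proof (rule AE_lborel_continuous_eq_0[where U = "{0<..<1}" and g = "\<lambda>s. cos_energy N x z (sqrt s * y)"])
  have "AE s in beta_measure \<alpha>. cos_energy N x z (sqrt s * y) = 0"
    using integral_nonneg_eq_0_iff_AE[OF quad_form_normalized_bessel(1)[OF assms(1)]]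
      cos_energy_nonneg assms(2) by auto
  then show "AE s in lborel. s \<in> {0<..<1} \<longrightarrow> cos_energy N x z (sqrt s * y) = 0"
    unfolding AE_beta_measure[OF assms(1)] .
  show "continuous_on UNIV (\<lambda>s. cos_energy N x z (sqrt s * y))"
    by (rule continuous_on_compose2[OF continuous_on_cos_energy[of UNIV]])
       (auto intro!: continuous_intros)
qed (use assms in auto)

lemma positive_definite_normalized_bessel:
  assumes "\<alpha> > -1/2"
  shows "positive_definite (\<lambda>x. of_real (normalized_bessel \<alpha> x))"
proof -
  have "0 \<le> quad_form N x z (\<lambda>\<xi>. of_real (normalized_bessel \<alpha> \<xi>))" for N x z
    using quad_form_normalized_bessel(2)[OF assms, of N x z 1]
    by (simp add: less_eq_complex_def cos_energy_nonneg)
  moreover have "continuous_on UNIV (\<lambda>x. complex_of_real (normalized_bessel \<alpha> x))"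
    by (intro continuous_on_of_real continuous_on_normalized_bessel[OF assms])
  ultimately show ?thesis
    unfolding positive_definite_def quad_form_def by blast
qed

text \<open>
  Strictness is inherited from the Fourier transform of \<open>\<mu>\<close> at the halved nodes: scaling the measure
  variable by \<open>1/2\<close> in an exponential sum is the same as scaling all nodes by \<open>1/2\<close>, which keeps
  them distinct.
\<close>
lemma strictly_positive_definite_bessel_transform:
  fixes \<mu> :: "real measure"
  assumes \<alpha>: "\<alpha> > -1/2" and fin: "finite_measure \<mu>" and sets [measurable_cong]: "sets \<mu> = sets borel"
    and spd: "strictly_positive_definite (fourier_measure \<mu>)"
  shows "strictly_positive_definite (\<lambda>\<xi>. of_real (\<integral>x. normalized_bessel \<alpha> (x * \<xi>) \<partial>\<mu>))"
proof -
  interpret finite_measure \<mu> by fact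
  have [measurable]: "normalized_bessel \<alpha> \<in> borel_measurable borel"
    by (intro borel_measurable_continuous_onI continuous_on_normalized_bessel[OF \<alpha>])
  have int: "integrable \<mu> (\<lambda>y. normalized_bessel \<alpha> (y * \<xi>))" for \<xi>
    by (rule integrable_const_bound[where B = 1]) (auto simp: abs_normalized_bessel_le_1[OF \<alpha>])
  have "continuous_on UNIV (\<lambda>\<xi>. \<integral>y. normalized_bessel \<alpha> (y * \<xi>) \<partial>\<mu>)"
  proof (rule continuous_on_integral_bounded[where B = 1, OF fin])
    show "continuous_on UNIV (\<lambda>\<xi>. normalized_bessel \<alpha> (y * \<xi>))" for y
      by (rule continuous_on_compose2[OF continuous_on_normalized_bessel[OF \<alpha>]])
         (auto intro!: continuous_intros)
  qed (auto simp: abs_normalized_bessel_le_1[OF \<alpha>])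
  then have cont: "continuous_on UNIV (\<lambda>\<xi>. complex_of_real (\<integral>y. normalized_bessel \<alpha> (y * \<xi>) \<partial>\<mu>))"
    by (rule continuous_on_of_real)
  have "0 < quad_form N x z (\<lambda>\<xi>. of_real (\<integral>y. normalized_bessel \<alpha> (y * \<xi>) \<partial>\<mu>))"
    if N: "N \<ge> 1" and inj: "inj_on x {1..N}" and z: "\<exists>j\<in>{1..N}. z j \<noteq> 0" for N x z
  proof -
    define F where "F y = (\<integral>s. cos_energy N x z (sqrt s * y) \<partial>beta_measure \<alpha>)" for y
    have F_nonneg: "F y \<ge> 0" for y
      unfolding F_def by (simp add: cos_energy_nonneg)
    note F = quad_form_integral_real[OF int quad_form_normalized_bessel(2)[OF \<alpha>, of N x z],
      folded F_def]
    have "integral\<^sup>L \<mu> F \<noteq> 0"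
    proof
      assume "integral\<^sup>L \<mu> F = 0"
      then have "AE y in \<mu>. F y = 0"
        using integral_nonneg_eq_0_iff_AE[OF F(1)] F_nonneg by auto
      then have "AE y in \<mu>. exp_poly N x z (1/2 * y) = 0"
      proof eventually_elim
        case (elim y)
        \<comment> \<open>Any fixed \<open>s\<close> in \<open>(0,1)\<close> would do; \<open>1/4\<close> has a rational square root.\<close>
        have "cos_energy N x z (sqrt (1/4) * y) = 0"
          using cos_energy_eq_0_of_integral_eq_0[OF \<alpha> elim[unfolded F_def], of "1/4"] by simp
        then show ?case by (intro cos_energy_eq_0_imp) (simp add: real_sqrt_divide)
      qed
      moreover have "exp_poly N x z (1/2 * y) = exp_poly N (\<lambda>j. 1/2 * x j) z y" for y
        by (simp add: exp_poly_def)
      ultimately have zero: "AE y in \<mu>. exp_poly N (\<lambda>j. 1/2 * x j) z y = 0"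
        by simp
      have "quad_form N (\<lambda>j. 1/2 * x j) z (fourier_measure \<mu>) =
          (\<integral>y. quad_form N (\<lambda>j. 1/2 * x j) z (\<lambda>\<xi>. exp (- (\<i> * of_real (y * \<xi>)))) \<partial>\<mu>)"
        unfolding fourier_measure_def
        by (intro quad_form_integral(2) integrable_const_bound[where B = 1]) auto
      also have "\<dots> = 0"
        unfolding quad_form_exp using zero by (intro integral_eq_zero_AE) auto
      finally have "quad_form N (\<lambda>j. 1/2 * x j) z (fourier_measure \<mu>) = 0" .
      moreover have "inj_on (\<lambda>j. 1/2 * x j) {1..N}"
        by (intro inj_onI) (rule inj_onD[OF inj], simp_all)
      then have "0 < quad_form N (\<lambda>j. 1/2 * x j) z (fourier_measure \<mu>)"
        using spd N z unfolding strictly_positive_definite_def quad_form_def by simp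
      ultimately show False by simp
    qed
    then have "integral\<^sup>L \<mu> F > 0"
      using F_nonneg by (simp add: order_less_le)
    then show ?thesis
      unfolding F(2) by (simp add: less_complex_def)
  qed
  with cont show ?thesis
    unfolding strictly_positive_definite_def quad_form_def by blast
qed

theorem proposition2:
  fixes \<alpha> :: real
  assumes "\<alpha> > -1/2"
  shows "positive_definite (\<lambda>x. complex_of_real (normalized_bessel \<alpha> x)) \<and>
    (\<forall>\<mu> :: real measure. finite_measure \<mu> \<longrightarrow> sets \<mu> = sets borel \<longrightarrow>
       strictly_positive_definite (fourier_measure \<mu>) \<longrightarrow>
       strictly_positive_definite
         (\<lambda>\<xi>. complex_of_real (\<integral>x. normalized_bessel \<alpha> (x * \<xi>) \<partial>\<mu>)))"
  using positive_definite_normalized_bessel[OF assms]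
    strictly_positive_definite_bessel_transform[OF assms] by blast

end
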